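(* Let $G$ be a finite group and let $H$ be a normal subgroup of $G$. Then the normal subgroup based power graph $\Gamma_H(G)$ is connected.
   Context: For a finite group $G$ with identity $e$ and a normal subgroup $H$ of $G$, the normal subgroup based power graph $\Gamma_H(G)$ is the simple undirected graph with vertex set $V(\Gamma_H(G))=(G\setminus H)\cup\{e\}$, in which two distinct vertices $x,y$ are adjacent if and only if $xH=y^mH$ or $yH=x^nH$ for some $m,n\in\mathbb{N}$. Here $\mathbb{N}$ denotes the positive integers. *)

theory Defs
  imports "HOL-Algebra.Coset" "Graph_Theory.Digraph_Component"
begin

text \<open>
  Undirected graphs are represented as in the AFP entry \<open>Graph_Theory\<close>: a simple undirected
  graph is a loop-free digraph without parallel arcs whose arc relation is symmetric
  (locale \<^locale>\<open>pair_graph\<close>), each edge being given by both of its orientations.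
\<close>

definition nsb_power_adj :: "('a, 'b) monoid_scheme \<Rightarrow> 'a set \<Rightarrow> 'a \<Rightarrow> 'a \<Rightarrow> bool" where
  "nsb_power_adj G H x y \<longleftrightarrow> x \<noteq> y \<and>
     ((\<exists>m::nat. m > 0 \<and> x <#\<^bsub>G\<^esub> H = (y [^]\<^bsub>G\<^esub> m) <#\<^bsub>G\<^esub> H) \<or>
      (\<exists>n::nat. n > 0 \<and> y <#\<^bsub>G\<^esub> H = (x [^]\<^bsub>G\<^esub> n) <#\<^bsub>G\<^esub> H))"

definition nsb_power_verts :: "('a, 'b) monoid_scheme \<Rightarrow> 'a set \<Rightarrow> 'a set" where
  "nsb_power_verts G H = (carrier G - H) \<union> {\<one>\<^bsub>G\<^esub>}"

definition nsb_power_graph :: "('a, 'b) monoid_scheme \<Rightarrow> 'a set \<Rightarrow> 'a pair_pre_digraph" where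
  "nsb_power_graph G H =
     \<lparr> pverts = nsb_power_verts G H,
       parcs = {(x, y). x \<in> nsb_power_verts G H \<and> y \<in> nsb_power_verts G H \<and>
                        nsb_power_adj G H x y} \<rparr>"

lemma nsb_power_graph_pair_graph:
  assumes "finite (carrier G)"
  shows "pair_graph (nsb_power_graph G H)"
proof -
  have fin: "finite (nsb_power_verts G H)"
    using assms by (simp add: nsb_power_verts_def)
  then have fin_arcs: "finite {(x, y). x \<in> nsb_power_verts G H \<and> y \<in> nsb_power_verts G H \<and>
      nsb_power_adj G H x y}"
    by (rule_tac finite_subset[of _ "nsb_power_verts G H \<times> nsb_power_verts G H"]) auto
  show ?thesis
    using fin fin_arcs
    by unfold_locales
      (auto simp: nsb_power_graph_def nsb_power_adj_def symmetric_def sym_def)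
qed

end

theory Submission
  imports Defs "HOL-Algebra.Multiplicative_Group"
begin

text \<open>The graph is a star around the identity with further edges added: by Lagrange, x raised
  to the order of the group is the identity, so the coset of the identity is that of a positive
  power of x. Any two vertices are then joined by a walk through the identity.\<close>

text \<open>
  The identity is adjacent to every other vertex \<open>x\<close>, because \<open>x\<close> raised to the order of the group is the identity.
\<close>

lemma (in group) nsb_power_adj_one:
  assumes "finite (carrier G)" and x: "x \<in> carrier G" and "x \<noteq> \<one>"
  shows "nsb_power_adj G H x \<one>"
proof -
  have "x [^] order G = \<one>"
    using x by (rule pow_order_eq_1)
  moreover have "order G > 0"
    using assms(1) by (simp add: order_gt_0_iff_finite)
  ultimately show ?thesis
    \<comment> \<open>The second disjunct holds with n = \<open>order G\<close>; finiteness makes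
      this exponent positive.\<close>
    using assms(3) unfolding nsb_power_adj_def by metis
qed

theorem proposition2p1:
  fixes G :: "('a, 'b) monoid_scheme" and H :: "'a set"
  assumes "group G" and "finite (carrier G)" and "H \<lhd> G"
  shows "Digraph_Component.connected (with_proj (nsb_power_graph G H))"
proof -
  interpret group G by fact
  let ?\<Gamma> = "nsb_power_graph G H"
  interpret pair_graph ?\<Gamma>
    using assms(2) by (rule nsb_power_graph_pair_graph)
  have one: "\<one>\<^bsub>G\<^esub> \<in> pverts ?\<Gamma>"
    by (simp add: nsb_power_graph_def nsb_power_verts_def)
  have to_one: "x \<rightarrow>\<^sup>*\<^bsub>?\<Gamma>\<^esub> \<one>\<^bsub>G\<^esub>" if x: "x \<in> pverts ?\<Gamma>" for x
  proof (cases "x = \<one>\<^bsub>G\<^esub>")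
    case True
    then show ?thesis using one by (simp add: reachable_refl)
  next
    case False
    then have "x \<in> carrier G"
      using x by (simp add: nsb_power_graph_def nsb_power_verts_def)
    then have "(x, \<one>\<^bsub>G\<^esub>) \<in> parcs ?\<Gamma>"
      using x one False nsb_power_adj_one[OF assms(2)]
      by (simp add: nsb_power_graph_def)
    then show ?thesis by simp
  qed
  show ?thesis
  proof (rule wf_digraph.connectedI[OF wf_digraph_axioms])
    show "verts (with_proj ?\<Gamma>) \<noteq> {}"
      using one by auto
  next
    fix u v
    assume "u \<in> verts (with_proj ?\<Gamma>)" and "v \<in> verts (with_proj ?\<Gamma>)"
    then have "u \<rightarrow>\<^sup>*\<^bsub>?\<Gamma>\<^esub> \<one>\<^bsub>G\<^esub>" and "v \<rightarrow>\<^sup>*\<^bsub>?\<Gamma>\<^esub> \<one>\<^bsub>G\<^esub>"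
      by (simp_all add: to_one)
    then have "u \<rightarrow>\<^sup>*\<^bsub>?\<Gamma>\<^esub> v"
      \<comment> \<open>Symmetry of the arcs reverses the walk from v, giving u to the identity to
        v.\<close>
      using symmetric_reachable[OF sym_arcs] reachable_trans by blast
    \<comment> \<open>\<open>connected\<close> refers to the symmetric closure, which contains every
      arc of the graph.\<close>
    then show "u \<rightarrow>\<^sup>*\<^bsub>mk_symmetric ?\<Gamma>\<^esub> v"
      by (rule reachable_mk_symmetricI)
  qed
qed

end
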